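(* Let $\mathcal{A}$ be a finite-dimensional evolution algebra over a field $\mathbb{K}$ with a natural basis $B=\{e_i\}_{i\in\Lambda}$, let $\mathfrak{m}=\operatorname{asi}(\mathcal{A})$, and let $\operatorname{rad}(\mathcal{A})=\operatorname{span}\{e_i : i\in\lambda_{\mathfrak{m}}(B)\}$. Then, for $i\in\Lambda$, $i\in\lambda_{\mathfrak{m}}(B)$ if and only if $i$ is an acyclic vertex of $\Gamma(\mathcal{A},B)$. Therefore $$\operatorname{rad}(\mathcal{A})=\operatorname{span}\{e_i : i \text{ is an acyclic vertex of } \Gamma(\mathcal{A},B)\}.$$
   Context: An evolution algebra over a field $\mathbb{K}$ (arbitrary characteristic) is a $\mathbb{K}$-algebra $\mathcal{A}$ (not necessarily associative) admitting a basis $B=\{e_i\}_{i\in\Lambda}$, called a natural basis, with $e_ie_j=0$ for $i\neq j$ and $e_i^2=\sum_{k\in\Lambda} w_{ik}e_k$, where $w_{ik}\in\mathbb{K}$. All algebras are finite-dimensional. The graph $\Gamma(\mathcal{A},B)$ is the directed graph with vertex set $\Lambda$ and an arrow $(i,k)$ exactly when $w_{ik}\neq 0$. For a vertex $i$, $D^1(i)=\{k\in\Lambda : (i,k)\text{ is an arrow}\}$. A path from $u$ to $v$ is a finite sequence of vertices $v_0v_1\dots v_n$ with $v_0=u$, $v_n=v$ and each $(v_i,v_{i+1})$ an arrow; its length is $n$. A cycle is a path of length $n\ge 1$ with $v_0=v_n$ (a loop is a cycle of length 1). A vertex $w$ is cyclic if there is a path from $w$ to a vertex of some cycle; otherwise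 $w$ is acyclic. An ideal $I$ of $\mathcal{A}$ has the absorption property if, for $x\in\mathcal{A}$, $x\mathcal{A}\subseteq I$ implies $x\in I$. The absorption radical $\operatorname{rad}(\mathcal{A})$ is the intersection of all ideals of $\mathcal{A}$ having the absorption property. The annihilator is $\operatorname{ann}(\mathcal{A})=\{x\in\mathcal{A}: x\mathcal{A}=\{0\}\}$. The upper annihilating series is defined by $\operatorname{ann}^{(0)}(\mathcal{A})=\{0\}$ and $\operatorname{ann}^{(i)}(\mathcal{A})/\operatorname{ann}^{(i-1)}(\mathcal{A})=\operatorname{ann}(\mathcal{A}/\operatorname{ann}^{(i-1)}(\mathcal{A}))$. The annihilator stabilizing index is $\operatorname{asi}(\mathcal{A})=\min\{q\ge 0:\operatorname{ann}^{(q)}(\mathcal{A})=\operatorname{ann}^{(q+1)}(\mathcal{A})\}$. Define $\lambda_0(B)=\emptyset$, $\lambda_1(B)=\{i\in\Lambda : e_i^2=0\}$ and $\lambda_k(B)=\{i\in\Lambda : D^1(i)\subseteq\lambda_{k-1}(B)\}$ for $k>1$. *)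

theory Defs
  imports
    Main
    "HOL-Library.Set_Algebras"
    "Graph_Theory.Pair_Digraph"
    "Graph_Theory.Vertex_Walk"
begin

text \<open>
  Explicit carrier and zero, so that the same notion applies to an algebra and to its quotients.
\<close>

definition annihilator_on :: "'a set \<Rightarrow> ('a \<Rightarrow> 'a \<Rightarrow> 'a) \<Rightarrow> 'a \<Rightarrow> 'a set" where
  "annihilator_on A m z = {x \<in> A. \<forall>y \<in> A. m x y = z}"

locale nonassoc_algebra = vector_space scale
  for scale :: "'k::field \<Rightarrow> 'a::ab_group_add \<Rightarrow> 'a" +
  fixes mult :: "'a \<Rightarrow> 'a \<Rightarrow> 'a"
  assumes linear_mult_right: "\<And>x. Vector_Spaces.linear scale scale (\<lambda>y. mult x y)"
    and linear_mult_left: "\<And>y. Vector_Spaces.linear scale scale (\<lambda>x. mult x y)"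
begin

definition ideal :: "'a set \<Rightarrow> bool" where
  "ideal I \<longleftrightarrow> subspace I \<and> (\<forall>x\<in>I. \<forall>a. mult x a \<in> I \<and> mult a x \<in> I)"

definition absorption :: "'a set \<Rightarrow> bool" where
  "absorption I \<longleftrightarrow> (\<forall>x. range (mult x) \<subseteq> I \<longrightarrow> x \<in> I)"

definition rad :: "'a set" where
  "rad = \<Inter>{I. ideal I \<and> absorption I}"

definition quot_carrier :: "'a set \<Rightarrow> 'a set set" where
  "quot_carrier I = range (\<lambda>x. x +o I)"

definition quot_mult :: "'a set \<Rightarrow> 'a set \<Rightarrow> 'a set \<Rightarrow> 'a set" where
  "quot_mult I X Y = (\<Union>x\<in>X. \<Union>y\<in>Y. mult x y +o I)"

definition ann :: "'a set" where
  "ann = annihilator_on UNIV mult 0"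

definition ann_quot :: "'a set \<Rightarrow> 'a set set" where
  "ann_quot I = annihilator_on (quot_carrier I) (quot_mult I) (0 +o I)"

text \<open>
  The members of the series are ideals when \<open>mult\<close> is commutative, as in evolution algebras.
  Each term is the full preimage of the annihilator of the quotient by the previous one.
\<close>

primrec ann_series :: "nat \<Rightarrow> 'a set" where
  "ann_series 0 = {0}"
| "ann_series (Suc q) = {x. x +o ann_series q \<in> ann_quot (ann_series q)}"

definition asi :: nat where
  "asi = (LEAST q. ann_series q = ann_series (Suc q))"

lemma ann_series_1: "ann_series 1 = ann"
  by (auto simp: ann_def ann_quot_def annihilator_on_def quot_carrier_def quot_mult_def
      elt_set_plus_def)

end

locale evolution_algebra = nonassoc_algebra scale mult
  for scale :: "'k::field \<Rightarrow> 'a::ab_group_add \<Rightarrow> 'a"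
    and mult :: "'a \<Rightarrow> 'a \<Rightarrow> 'a" +
  fixes \<Lambda> :: "'i set"
    and e :: "'i \<Rightarrow> 'a"
  assumes finite_index: "finite \<Lambda>"
    and inj_basis: "inj_on e \<Lambda>"
    and independent_basis: "independent (e ` \<Lambda>)"
    and span_basis: "span (e ` \<Lambda>) = UNIV"
    and mult_basis: "\<And>i j. i \<in> \<Lambda> \<Longrightarrow> j \<in> \<Lambda> \<Longrightarrow> i \<noteq> j \<Longrightarrow> mult (e i) (e j) = 0"
begin

definition w :: "'i \<Rightarrow> 'i \<Rightarrow> 'k" where
  "w i k = representation (e ` \<Lambda>) (mult (e i) (e i)) (e k)"

lemma square_basis: "mult (e i) (e i) = (\<Sum>k\<in>\<Lambda>. scale (w i k) (e k))"
proof -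
  have "(\<Sum>b\<in>e ` \<Lambda>. scale (representation (e ` \<Lambda>) (mult (e i) (e i)) b) b) = mult (e i) (e i)"
    by (rule sum_representation_eq) (use finite_index independent_basis span_basis in auto)
  then show ?thesis
    by (simp add: w_def sum.reindex[OF inj_basis])
qed

definition graph :: "'i pair_pre_digraph" where
  "graph = \<lparr> pverts = \<Lambda>, parcs = {(i, k). i \<in> \<Lambda> \<and> k \<in> \<Lambda> \<and> w i k \<noteq> 0} \<rparr>"

definition D1 :: "'i \<Rightarrow> 'i set" where
  "D1 i = {k \<in> \<Lambda>. (i, k) \<in> parcs graph}"

text \<open>
  Paths are the library's vertex walks: nonempty vertex sequences, possibly with repetitions.
  Likewise cycles are closed walks, not necessarily simple.
\<close>

definition is_path :: "'i \<Rightarrow> 'i list \<Rightarrow> 'i \<Rightarrow> bool" where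
  "is_path u p v \<longleftrightarrow> vwalk p (with_proj graph) \<and> hd p = u \<and> last p = v"

definition is_cycle :: "'i list \<Rightarrow> bool" where
  "is_cycle c \<longleftrightarrow> is_path (hd c) c (hd c) \<and> vwalk_length c \<ge> 1"

definition cyclic_vertex :: "'i \<Rightarrow> bool" where
  "cyclic_vertex i \<longleftrightarrow> i \<in> \<Lambda> \<and> (\<exists>c p v. is_cycle c \<and> v \<in> set c \<and> is_path i p v)"

definition acyclic_vertex :: "'i \<Rightarrow> bool" where
  "acyclic_vertex i \<longleftrightarrow> i \<in> \<Lambda> \<and> \<not> cyclic_vertex i"

fun lambda :: "nat \<Rightarrow> 'i set" where
  "lambda 0 = {}"
| "lambda (Suc 0) = {i \<in> \<Lambda>. mult (e i) (e i) = 0}"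
| "lambda (Suc (Suc k)) = {i \<in> \<Lambda>. D1 i \<subseteq> lambda (Suc k)}"

end

end

theory Submission
  imports Defs
begin

text \<open>
  In a natural basis the product is diagonal, \<open>x y = \<Sum>\<^sub>i x\<^sub>i y\<^sub>i e\<^sub>i\<^sup>2\<close>, and \<open>e\<^sub>i\<^sup>2\<close> lies in the span
  of \<open>{e\<^sub>k | k \<in> S}\<close> exactly when \<open>D\<^sup>1(i) \<subseteq> S\<close>. Hence \<open>x\<A>\<close> is contained in that span if and only
  if \<open>x\<close> is supported on the vertices all of whose successors lie in \<open>S\<close>
  (\<open>range_mult_subset_span_iff\<close>), and by induction the upper annihilating series is
  \<open>ann\<^sub>q = span {e\<^sub>i | i \<in> \<lambda>\<^sub>q}\<close> (\<open>ann_series_eq_span_lambda\<close>). The sets \<open>\<lambda>\<^sub>q\<close> increase inside the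
  finite set \<open>\<Lambda>\<close>, so the series stabilizes, and linear independence turns stability of the series at
  \<open>\<mm> = asi(\<A>)\<close> into stability of \<open>\<lambda>\<close>: a vertex lies in \<open>\<lambda>\<^sub>\<mm>\<close> if and only if all its successors
  do (\<open>lambda_asi_iff\<close>).

  The acyclic vertices satisfy the same equivalence. A cyclic vertex has a cyclic successor, so
  induction on \<open>q\<close> shows that no \<open>\<lambda>\<^sub>q\<close> contains a cyclic vertex. Conversely, the arrows between
  acyclic vertices form a finite acyclic relation, whose converse is therefore well-founded, and
  well-founded induction along successors puts every acyclic vertex into \<open>\<lambda>\<^sub>\<mm>\<close>. The formula for the
  radical then follows from its description as the span of \<open>{e\<^sub>i | i \<in> \<lambda>\<^sub>\<mm>}\<close>.
\<close>

section \<open>The upper annihilating series\<close>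

context nonassoc_algebra
begin

lemma mult_add_left: "mult (x + y) z = mult x z + mult y z"
  by (rule module_hom.add[OF module_hom_linearI[OF linear_mult_left]])

lemma mult_add_right: "mult z (x + y) = mult z x + mult z y"
  by (rule module_hom.add[OF module_hom_linearI[OF linear_mult_right]])

lemma mult_scale_left: "mult (scale c x) z = scale c (mult x z)"
  by (rule module_hom.scale[OF module_hom_linearI[OF linear_mult_left]])

lemma mult_scale_right: "mult z (scale c x) = scale c (mult z x)"
  by (rule module_hom.scale[OF module_hom_linearI[OF linear_mult_right]])

lemma mult_sum_left: "mult (sum f A) z = (\<Sum>i\<in>A. mult (f i) z)"
  by (rule module_hom.sum[OF module_hom_linearI[OF linear_mult_left]])

lemma mult_sum_right: "mult z (sum f A) = (\<Sum>i\<in>A. mult z (f i))"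
  by (rule module_hom.sum[OF module_hom_linearI[OF linear_mult_right]])

lemma coset_eq_iff:
  assumes "subspace I"
  shows "x +o I = I \<longleftrightarrow> x \<in> I"
proof
  assume "x +o I = I"
  moreover have "x + 0 \<in> x +o I"
    using subspace_0[OF assms] by blast
  ultimately show "x \<in> I" by simp
next
  assume x: "x \<in> I"
  show "x +o I = I"
  proof
    show "x +o I \<subseteq> I"
      using x by (auto simp: elt_set_plus_def intro: subspace_add[OF assms])
    show "I \<subseteq> x +o I"
    proof
      fix y assume "y \<in> I"
      then have "x + (y - x) \<in> x +o I"
        using x by (blast intro: subspace_diff[OF assms])
      then show "y \<in> x +o I" by simp
    qed
  qed
qed

text \<open>
  The product of two cosets is a union over all representatives; for an ideal all the cosets in that
  union coincide.
\<close>

lemma quot_mult_coset: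
  assumes "ideal I"
  shows "quot_mult I (x +o I) (y +o I) = mult x y +o I"
proof -
  have sub: "subspace I" using assms by (simp add: ideal_def)
  have "mult (x + a) (y + b) +o I = mult x y +o I" if "a \<in> I" "b \<in> I" for a b
  proof -
    have "mult x b + (mult a y + mult a b) \<in> I"
      using assms that sub by (auto simp: ideal_def intro!: subspace_add)
    then have "(mult x b + (mult a y + mult a b)) +o I = I"
      using coset_eq_iff[OF sub] by simp
    moreover have "mult (x + a) (y + b) = mult x y + (mult x b + (mult a y + mult a b))"
      by (simp add: mult_add_left mult_add_right algebra_simps)
    ultimately show ?thesis
      by (metis set_plus_rearrange2)
  qed
  then have "(\<Union>a\<in>I. \<Union>b\<in>I. mult (x + a) (y + b) +o I) = (\<Union>a\<in>I. \<Union>b\<in>I. mult x y +o I)"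
    by simp
  moreover have "quot_mult I (x +o I) (y +o I) = (\<Union>a\<in>I. \<Union>b\<in>I. mult (x + a) (y + b) +o I)"
    unfolding quot_mult_def elt_set_plus_def by blast
  moreover have "I \<noteq> {}"
    using subspace_0[OF sub] by blast
  ultimately show ?thesis
    by simp
qed

text \<open>This removes the quotient from the recursion of the series.\<close>

lemma ann_series_Suc_ideal:
  assumes "ideal (ann_series q)"
  shows "ann_series (Suc q) = {x. range (mult x) \<subseteq> ann_series q}"
proof -
  have sub: "subspace (ann_series q)" using assms by (simp add: ideal_def)
  have "0 +o ann_series q = ann_series q"
    using coset_eq_iff[OF sub] subspace_0[OF sub] by simp
  then show ?thesis
    by (auto simp: ann_quot_def annihilator_on_def quot_carrier_def
        quot_mult_coset[OF assms] coset_eq_iff[OF sub])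
qed

end

section \<open>Coordinates in a natural basis\<close>

context evolution_algebra
begin

text \<open>The coefficient of a vector at a basis index.\<close>

definition coord :: "'a \<Rightarrow> 'i \<Rightarrow> 'k" where
  "coord x i = representation (e ` \<Lambda>) x (e i)"

lemma sum_coord: "(\<Sum>i\<in>\<Lambda>. scale (coord x i) (e i)) = x"
proof -
  have "(\<Sum>b\<in>e ` \<Lambda>. scale (representation (e ` \<Lambda>) x b) b) = x"
    by (rule sum_representation_eq) (use finite_index independent_basis span_basis in auto)
  then show ?thesis
    by (simp add: coord_def sum.reindex[OF inj_basis])
qed

lemma coord_basis:
  assumes "i \<in> \<Lambda>" "k \<in> \<Lambda>"
  shows "coord (e i) k = (if k = i then 1 else 0)"
  using assms inj_basis
  by (auto simp: coord_def representation_basis[OF independent_basis] inj_on_eq_iff)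

lemma coord_square: "coord (mult (e i) (e i)) k = w i k"
  by (simp add: coord_def w_def)

lemma mem_span_iff:
  assumes S: "S \<subseteq> \<Lambda>"
  shows "x \<in> span (e ` S) \<longleftrightarrow> (\<forall>i\<in>\<Lambda>. coord x i \<noteq> 0 \<longrightarrow> i \<in> S)"
proof
  assume x: "x \<in> span (e ` S)"
  have eq: "representation (e ` \<Lambda>) x = representation (e ` S) x"
    by (rule representation_extend[OF independent_basis x]) (use S in blast)
  show "\<forall>i\<in>\<Lambda>. coord x i \<noteq> 0 \<longrightarrow> i \<in> S"
  proof (intro ballI impI)
    fix i assume i: "i \<in> \<Lambda>" and "coord x i \<noteq> 0"
    then have "e i \<in> e ` S"
      using representation_ne_zero by (simp add: coord_def eq)
    then show "i \<in> S"
      using inj_on_image_mem_iff[OF inj_basis i S] by simp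
  qed
next
  assume supp: "\<forall>i\<in>\<Lambda>. coord x i \<noteq> 0 \<longrightarrow> i \<in> S"
  have "scale (coord x i) (e i) \<in> span (e ` S)" if "i \<in> \<Lambda>" for i
    using supp that by (cases "coord x i = 0") (auto intro: span_scale span_base simp: span_zero)
  then have "(\<Sum>i\<in>\<Lambda>. scale (coord x i) (e i)) \<in> span (e ` S)"
    by (rule span_sum)
  then show "x \<in> span (e ` S)"
    by (simp add: sum_coord)
qed

lemma basis_mem_span_iff:
  assumes "S \<subseteq> \<Lambda>" "i \<in> \<Lambda>"
  shows "e i \<in> span (e ` S) \<longleftrightarrow> i \<in> S"
  using assms by (simp add: mem_span_iff coord_basis)

lemma mult_eq_sum: "mult x y = (\<Sum>i\<in>\<Lambda>. scale (coord x i * coord y i) (mult (e i) (e i)))"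
proof -
  have "mult x y = mult (\<Sum>i\<in>\<Lambda>. scale (coord x i) (e i)) (\<Sum>j\<in>\<Lambda>. scale (coord y j) (e j))"
    by (simp add: sum_coord)
  also have "\<dots> = (\<Sum>i\<in>\<Lambda>. mult (scale (coord x i) (e i)) (\<Sum>j\<in>\<Lambda>. scale (coord y j) (e j)))"
    by (rule mult_sum_left)
  also have "\<dots> = (\<Sum>i\<in>\<Lambda>. \<Sum>j\<in>\<Lambda>. scale (coord x i * coord y j) (mult (e i) (e j)))"
    unfolding mult_sum_right by (simp add: mult_scale_left mult_scale_right mult.commute)
  also have "\<dots> = (\<Sum>i\<in>\<Lambda>. \<Sum>j\<in>\<Lambda>. if j = i then scale (coord x i * coord y i) (mult (e i) (e i)) else 0)"
    by (intro sum.cong refl) (auto simp: mult_basis)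
  also have "\<dots> = (\<Sum>i\<in>\<Lambda>. scale (coord x i * coord y i) (mult (e i) (e i)))"
    using finite_index by simp
  finally show ?thesis .
qed

lemma mult_commute: "mult x y = mult y x"
  by (simp add: mult_eq_sum[of x] mult_eq_sum[of y] mult.commute)

lemma mult_basis_right:
  assumes "i \<in> \<Lambda>"
  shows "mult x (e i) = scale (coord x i) (mult (e i) (e i))"
proof -
  have "mult x (e i) = (\<Sum>k\<in>\<Lambda>. if k = i then scale (coord x i) (mult (e i) (e i)) else 0)"
    unfolding mult_eq_sum[of x] by (intro sum.cong refl) (auto simp: coord_basis assms)
  then show ?thesis
    using finite_index assms by simp
qed

lemma mem_D1_iff: "k \<in> D1 i \<longleftrightarrow> i \<in> \<Lambda> \<and> k \<in> \<Lambda> \<and> w i k \<noteq> 0"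
  by (auto simp: D1_def graph_def)

lemma square_mem_span_iff:
  assumes "S \<subseteq> \<Lambda>" "i \<in> \<Lambda>"
  shows "mult (e i) (e i) \<in> span (e ` S) \<longleftrightarrow> D1 i \<subseteq> S"
  using assms by (auto simp: mem_span_iff coord_square mem_D1_iff)

lemma range_mult_subset_span_iff:
  assumes S: "S \<subseteq> \<Lambda>"
  shows "range (mult x) \<subseteq> span (e ` S) \<longleftrightarrow> x \<in> span (e ` {i \<in> \<Lambda>. D1 i \<subseteq> S})"
proof
  assume ran: "range (mult x) \<subseteq> span (e ` S)"
  have "D1 i \<subseteq> S" if i: "i \<in> \<Lambda>" and nz: "coord x i \<noteq> 0" for i
  proof -
    have "scale (coord x i) (mult (e i) (e i)) \<in> span (e ` S)"
      using ran by (auto simp flip: mult_basis_right[OF i])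
    then have "scale (inverse (coord x i)) (scale (coord x i) (mult (e i) (e i))) \<in> span (e ` S)"
      by (rule span_scale)
    then show ?thesis
      using nz by (simp add: square_mem_span_iff[OF S i])
  qed
  then show "x \<in> span (e ` {i \<in> \<Lambda>. D1 i \<subseteq> S})"
    by (subst mem_span_iff) auto
next
  assume "x \<in> span (e ` {i \<in> \<Lambda>. D1 i \<subseteq> S})"
  then have supp: "D1 i \<subseteq> S" if "i \<in> \<Lambda>" "coord x i \<noteq> 0" for i
    using that by (subst (asm) mem_span_iff) auto
  have "mult x y \<in> span (e ` S)" for y
    unfolding mult_eq_sum[of x]
  proof (rule span_sum)
    fix i assume i: "i \<in> \<Lambda>"
    show "scale (coord x i * coord y i) (mult (e i) (e i)) \<in> span (e ` S)"
      using supp[OF i] square_mem_span_iff[OF S i]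
      by (cases "coord x i = 0") (auto intro: span_scale simp: span_zero)
  qed
  then show "range (mult x) \<subseteq> span (e ` S)" by auto
qed

lemma ideal_span:
  assumes S: "S \<subseteq> \<Lambda>" and closed: "\<And>i. i \<in> S \<Longrightarrow> D1 i \<subseteq> S"
  shows "ideal (span (e ` S))"
proof -
  have "span (e ` S) \<subseteq> span (e ` {i \<in> \<Lambda>. D1 i \<subseteq> S})"
    using S closed by (intro span_mono) auto
  then have "mult x a \<in> span (e ` S)" if "x \<in> span (e ` S)" for x a
    using that range_mult_subset_span_iff[OF S] by blast
  then show ?thesis
    by (auto simp: ideal_def mult_commute)
qed

section \<open>The annihilating series in terms of the graph\<close>

text \<open>
  One recursion serves every level: the vertices with zero square are those without successors, that
  is, those with all successors in \<open>\<lambda>\<^sub>0 = {}\<close>.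
\<close>

lemma lambda_Suc: "lambda (Suc q) = {i \<in> \<Lambda>. D1 i \<subseteq> lambda q}"
proof (cases q)
  case 0
  have "mult (e i) (e i) = 0 \<longleftrightarrow> D1 i \<subseteq> {}" if "i \<in> \<Lambda>" for i
    using square_mem_span_iff[of "{}" i] that by simp
  then show ?thesis
    using 0 by auto
qed simp

lemma lambda_subset: "lambda q \<subseteq> \<Lambda>"
  by (cases q) (auto simp: lambda_Suc)

lemma lambda_mono_Suc: "lambda q \<subseteq> lambda (Suc q)"
proof (induction q)
  case (Suc q)
  have "{i \<in> \<Lambda>. D1 i \<subseteq> lambda q} \<subseteq> {i \<in> \<Lambda>. D1 i \<subseteq> lambda (Suc q)}"
    using Suc.IH by blast
  then show ?case
    by (simp only: lambda_Suc[of q, symmetric] lambda_Suc[of "Suc q", symmetric])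
qed simp

lemma ideal_span_lambda: "ideal (span (e ` lambda q))"
  using lambda_mono_Suc[of q] by (intro ideal_span lambda_subset) (auto simp: lambda_Suc)

lemma ann_series_eq_span_lambda: "ann_series q = span (e ` lambda q)"
proof (induction q)
  case (Suc q)
  have "ann_series (Suc q) = {x. range (mult x) \<subseteq> ann_series q}"
    by (rule ann_series_Suc_ideal) (simp only: Suc.IH ideal_span_lambda)
  then show ?case
    by (simp add: Suc.IH range_mult_subset_span_iff[OF lambda_subset] lambda_Suc del: ann_series.simps)
qed simp

lemma lambda_stabilizes: "\<exists>q. lambda q = lambda (Suc q)"
proof (rule ccontr)
  assume "\<nexists>q. lambda q = lambda (Suc q)"
  then have strict: "lambda q \<subset> lambda (Suc q)" for q
    using lambda_mono_Suc[of q] by blast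
  have "q \<le> card (lambda q)" for q
  proof (induction q)
    case (Suc q)
    have "card (lambda q) < card (lambda (Suc q))"
      by (intro psubset_card_mono strict finite_subset[OF lambda_subset finite_index])
    with Suc.IH show ?case by simp
  qed simp
  from this[of "Suc (card \<Lambda>)"] show False
    using card_mono[OF finite_index lambda_subset[of "Suc (card \<Lambda>)"]] by simp
qed

text \<open>
  This also covers \<open>asi = 0\<close>: then \<open>\<lambda>\<^sub>1 = \<lambda>\<^sub>0 = {}\<close>, so every vertex has a successor.
\<close>

lemma lambda_asi_iff: "i \<in> lambda asi \<longleftrightarrow> i \<in> \<Lambda> \<and> D1 i \<subseteq> lambda asi"
proof -
  have "\<exists>q. ann_series q = ann_series (Suc q)"
    using lambda_stabilizes by (metis ann_series_eq_span_lambda)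
  then have "ann_series asi = ann_series (Suc asi)"
    unfolding asi_def by (rule LeastI_ex)
  then have "span (e ` lambda asi) = span (e ` lambda (Suc asi))"
    by (simp only: ann_series_eq_span_lambda)
  then have "lambda asi = lambda (Suc asi)"
    using basis_mem_span_iff[OF lambda_subset] lambda_subset by blast
  then show ?thesis
    using lambda_Suc by blast
qed

section \<open>Cyclic and acyclic vertices\<close>

lemma wf_digraph_graph: "wf_digraph (with_proj graph)"
  by unfold_locales (auto simp: graph_def)

lemma ex_path_iff: "(\<exists>p. is_path u p v) \<longleftrightarrow> u \<in> \<Lambda> \<and> v \<in> \<Lambda> \<and> (u, v) \<in> (parcs graph)\<^sup>*"
  using wf_digraph.reachable_vwalk_conv[OF wf_digraph_graph, of u v]
    wf_digraph.reachable_conv[OF wf_digraph_graph, of u v]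
  by (auto simp: is_path_def graph_def)

lemma is_path_imp_rtrancl: "is_path u p v \<Longrightarrow> (u, v) \<in> (parcs graph)\<^sup>*"
  using ex_path_iff by blast

lemma cycle_vertex_trancl:
  assumes c: "is_cycle c" and v: "v \<in> set c"
  shows "(v, v) \<in> (parcs graph)\<^sup>+"
proof -
  have walk: "vwalk c (with_proj graph)" and last: "last c = hd c" and len: "length c \<ge> 2"
    using c by (auto simp: is_cycle_def is_path_def)
  show ?thesis
  proof (cases "v = hd c")
    case True
    \<comment> \<open>Splitting the walk at its first vertex would give two paths, one of length \<open>0\<close>; the first arrow
      of the cycle is used instead.\<close>
    obtain c' where c': "c = v # c'" "c' \<noteq> []"
      using True len by (cases c) force+
    have arc: "(v, hd c') \<in> parcs graph" and walk': "vwalk c' (with_proj graph)"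
      using vwalk_consE[of v c' "with_proj graph"] walk c' by auto
    have "is_path (hd c') c' v"
      using walk' last c' by (simp add: is_path_def)
    then show ?thesis
      using arc is_path_imp_rtrancl by (meson rtrancl_into_trancl2)
  next
    case False
    obtain xs ys where split: "c = xs @ v # ys"
      using v by (meson split_list)
    have "vwalk (xs @ [v]) (with_proj graph)"
      using walk split vwalkI_append_l[of "xs @ [v]" ys] by simp
    then have "is_path (hd c) (xs @ [v]) v"
      by (auto simp: is_path_def split hd_append)
    moreover have "vwalk (v # ys) (with_proj graph)"
      using walk split vwalkI_append_r[of "v # ys" xs] by simp
    then have "is_path v (v # ys) (hd c)"
      using last split by (simp add: is_path_def)
    ultimately show ?thesis
      using False is_path_imp_rtrancl by (meson rtranclD rtrancl_trancl_trancl trancl_rtrancl_trancl)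
  qed
qed

text \<open>
  A closed walk is a cycle through each of its vertices, so a vertex is cyclic exactly when it
  reaches a vertex that reaches itself by a nonempty path.
\<close>

lemma cyclic_vertex_iff:
  "cyclic_vertex i \<longleftrightarrow> i \<in> \<Lambda> \<and> (\<exists>v. (i, v) \<in> (parcs graph)\<^sup>* \<and> (v, v) \<in> (parcs graph)\<^sup>+)"
proof
  assume "cyclic_vertex i"
  then show "i \<in> \<Lambda> \<and> (\<exists>v. (i, v) \<in> (parcs graph)\<^sup>* \<and> (v, v) \<in> (parcs graph)\<^sup>+)"
    unfolding cyclic_vertex_def using cycle_vertex_trancl is_path_imp_rtrancl by blast
next
  assume "i \<in> \<Lambda> \<and> (\<exists>v. (i, v) \<in> (parcs graph)\<^sup>* \<and> (v, v) \<in> (parcs graph)\<^sup>+)"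
  then obtain v where i: "i \<in> \<Lambda>" and iv: "(i, v) \<in> (parcs graph)\<^sup>*"
    and vv: "(v, v) \<in> (parcs graph)\<^sup>+" by blast
  obtain k where vk: "(v, k) \<in> parcs graph" and kv: "(k, v) \<in> (parcs graph)\<^sup>*"
    using vv by (meson tranclD)
  have vL: "v \<in> \<Lambda>" and kL: "k \<in> \<Lambda>"
    using vk by (auto simp: graph_def)
  obtain p where p: "is_path i p v"
    using i iv vL ex_path_iff by blast
  obtain r where r: "is_path k r v"
    using kL kv vL ex_path_iff by blast
  have "vwalk (v # r) (with_proj graph)"
    using r vk vL by (intro vwalk_consI) (auto simp: is_path_def graph_def)
  moreover have "r \<noteq> []"
    using r by (auto simp: is_path_def)
  ultimately have "is_cycle (v # r)"
    using r by (cases r) (auto simp: is_cycle_def is_path_def)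
  then show "cyclic_vertex i"
    unfolding cyclic_vertex_def using i p by (meson list.set_intros(1))
qed

lemma cyclic_vertex_successor:
  assumes "cyclic_vertex i"
  obtains k where "k \<in> D1 i" "cyclic_vertex k"
proof -
  obtain v where iv: "(i, v) \<in> (parcs graph)\<^sup>*" and vv: "(v, v) \<in> (parcs graph)\<^sup>+"
    using assms by (auto simp: cyclic_vertex_iff)
  have "(i, v) \<in> (parcs graph)\<^sup>+"
    using iv vv by (rule rtrancl_trancl_trancl)
  then obtain k where k: "(i, k) \<in> parcs graph" "(k, v) \<in> (parcs graph)\<^sup>*"
    by (meson tranclD)
  then have "k \<in> \<Lambda>" by (auto simp: graph_def)
  with k vv show ?thesis
    by (intro that[of k]) (auto simp: D1_def cyclic_vertex_iff)
qed

lemma cyclic_vertex_predecessor: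
  assumes "k \<in> D1 i" "cyclic_vertex k"
  shows "cyclic_vertex i"
proof -
  have "(i, k) \<in> parcs graph" "i \<in> \<Lambda>"
    using assms(1) by (auto simp: D1_def graph_def)
  then show ?thesis
    using assms(2) by (auto simp: cyclic_vertex_iff intro: converse_rtrancl_into_rtrancl)
qed

text \<open>No stability is needed here: the claim holds at every level.\<close>

lemma cyclic_vertex_notin_lambda: "cyclic_vertex i \<Longrightarrow> i \<notin> lambda q"
proof (induction q arbitrary: i)
  case (Suc q)
  obtain k where "k \<in> D1 i" "cyclic_vertex k"
    using Suc.prems by (rule cyclic_vertex_successor)
  then show ?case
    using Suc.IH[of k] by (auto simp: lambda_Suc)
qed simp

lemma acyclic_vertex_in_lambda_asi:
  assumes "acyclic_vertex i"
  shows "i \<in> lambda asi"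
proof -
  \<comment> \<open>Acyclic vertices have only acyclic successors, so the graph may be restricted to them.\<close>
  define N where "N = {i. acyclic_vertex i}"
  define R where "R = parcs graph \<inter> N \<times> N"
  have "finite (parcs graph)"
    by (rule finite_subset[of _ "\<Lambda> \<times> \<Lambda>"]) (auto simp: graph_def finite_index)
  then have "finite R"
    by (simp add: R_def)
  moreover have "acyclic R"
  proof (rule acyclicI, intro allI notI)
    fix v assume vv: "(v, v) \<in> R\<^sup>+"
    then have "(v, v) \<in> (parcs graph)\<^sup>+"
      by (rule trancl_mono) (auto simp: R_def)
    moreover have "v \<in> N"
      using tranclD[OF vv] by (auto simp: R_def)
    ultimately show False
      by (auto simp: N_def acyclic_vertex_def cyclic_vertex_iff)
  qed
  ultimately have "wf (R\<inverse>)"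
    by (rule finite_acyclic_wf_converse)
  then show ?thesis
    using assms
  proof (induction i rule: wf_induct_rule)
    case (less i)
    have i: "i \<in> \<Lambda>" using less.prems by (simp add: acyclic_vertex_def)
    have "k \<in> lambda asi" if k: "k \<in> D1 i" for k
    proof -
      have "acyclic_vertex k"
        using k less.prems cyclic_vertex_predecessor
        by (auto simp: acyclic_vertex_def mem_D1_iff)
      moreover have "(k, i) \<in> R\<inverse>"
        using k less.prems calculation by (auto simp: R_def N_def D1_def)
      ultimately show ?thesis
        using less.IH by blast
    qed
    then show ?case
      using i lambda_asi_iff by blast
  qed
qed

lemma lambda_asi_eq_acyclic: "lambda asi = {i. acyclic_vertex i}"
  using acyclic_vertex_in_lambda_asi cyclic_vertex_notin_lambda lambda_subset[of asi]
  by (auto simp: acyclic_vertex_def)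

end

section \<open>The absorption radical\<close>

theorem theorem3p10:
  fixes scale :: "'k::field \<Rightarrow> 'a::ab_group_add \<Rightarrow> 'a"
    and mult :: "'a \<Rightarrow> 'a \<Rightarrow> 'a"
    and \<Lambda> :: "'i set"
    and e :: "'i \<Rightarrow> 'a"
    and m :: nat
  assumes "evolution_algebra scale mult \<Lambda> e"
    and "m = nonassoc_algebra.asi mult"
    and "nonassoc_algebra.rad scale mult =
         module.span scale (e ` evolution_algebra.lambda scale mult \<Lambda> e m)"
  shows "(\<forall>i\<in>\<Lambda>. i \<in> evolution_algebra.lambda scale mult \<Lambda> e m \<longleftrightarrow>
            evolution_algebra.acyclic_vertex scale mult \<Lambda> e i)
       \<and> nonassoc_algebra.rad scale mult =
         module.span scale (e ` {i. evolution_algebra.acyclic_vertex scale mult \<Lambda> e i})"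
proof -
  have "evolution_algebra.lambda scale mult \<Lambda> e m =
      {i. evolution_algebra.acyclic_vertex scale mult \<Lambda> e i}"
    using evolution_algebra.lambda_asi_eq_acyclic[OF assms(1)] assms(2) by simp
  then show ?thesis
    using assms(3) by simp
qed

end
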